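(* Let $n\ge0$ be an integer. The dual third order Jacobsthal vector $\overrightarrow{JD_{n}^{(3)}}$ is a dual unit vector if and only if $$3\cdot 2^{2(n+1)}-2^{n+2}U_{n}=5\quad\text{and}\quad 3\cdot 2^{2n+3}-2^{n+1}(U_{n}-U_{n+2})=1,$$ where $U_{n}=H_{n}(0,1)$.
   Context: Dual numbers are $a+\varepsilon b$ with $a,b\in\mathbb{R}$, $\varepsilon\ne0$, $\varepsilon^2=0$. The third order Jacobsthal numbers are defined by $J_0^{(3)}=0$, $J_1^{(3)}=J_2^{(3)}=1$, $J_{n+3}^{(3)}=J_{n+2}^{(3)}+J_{n+1}^{(3)}+2J_n^{(3)}$ for $n\ge0$. For $n\ge0$ let $\overrightarrow{J_n^{(3)}}=(J_n^{(3)},J_{n+1}^{(3)},J_{n+2}^{(3)})\in\mathbb{R}^3$, and define the dual third order Jacobsthal vector $\overrightarrow{JD_n^{(3)}}=\overrightarrow{J_n^{(3)}}+\varepsilon\overrightarrow{J_{n+1}^{(3)}}$. The norm of a dual vector $\overrightarrow{d}=\overrightarrow{a}+\varepsilon\overrightarrow{b}$ ($\overrightarrow{a},\overrightarrow{b}\in\mathbb{R}^3$, $\overrightarrow{a}\neq 0$) is the dual number $\|\overrightarrow{d}\|=\|\overrightarrow{a}\|+\varepsilon\frac{\langle\overrightarrow{a},\overrightarrow{b}\rangle}{\|\overrightarrow{a}\|}$, with the standard Euclidean norm and inner product on $\mathbb{R}^3$; $\overrightarrow{d}$ is a dual unit vector if $\|\overrightarrow{d}\|=1$, i.e. iff $\|\overrightarrow{a}\|=1$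 and $\langle\overrightarrow{a},\overrightarrow{b}\rangle=0$. For real $a,b$ and an integer $n$, $H_n(a,b)=a$ if $n\equiv0\pmod 3$, $H_n(a,b)=b$ if $n\equiv1\pmod 3$, $H_n(a,b)=-(a+b)$ if $n\equiv2\pmod 3$. *)

theory Defs
  imports "HOL-Analysis.Analysis"
begin

text \<open>
  \<open>Dual a b\<close> stands for \<open>a + \<epsilon> b\<close>. The type is polymorphic in the coefficients, so that
  \<open>real dual\<close> below is the type of dual numbers and \<open>(real ^ 3) dual\<close> that of dual vectors.
\<close>

datatype 'a dual = Dual (rpart: 'a) (dpart: 'a)

instantiation dual :: (comm_ring_1) comm_ring_1
begin

definition zero_dual :: "'a dual" where "0 = Dual 0 0"
definition one_dual :: "'a dual" where "1 = Dual 1 0"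
definition plus_dual :: "'a dual \<Rightarrow> 'a dual \<Rightarrow> 'a dual" where
  "x + y = Dual (rpart x + rpart y) (dpart x + dpart y)"
definition uminus_dual :: "'a dual \<Rightarrow> 'a dual" where
  "- x = Dual (- rpart x) (- dpart x)"
definition minus_dual :: "'a dual \<Rightarrow> 'a dual \<Rightarrow> 'a dual" where
  "x - y = Dual (rpart x - rpart y) (dpart x - dpart y)"
definition times_dual :: "'a dual \<Rightarrow> 'a dual \<Rightarrow> 'a dual" where
  "x * y = Dual (rpart x * rpart y) (rpart x * dpart y + dpart x * rpart y)"

instance
  by standard
    (simp_all add: zero_dual_def one_dual_def plus_dual_def uminus_dual_def minus_dual_def
      times_dual_def algebra_simps)

end

definition dual_eps :: "'a::comm_ring_1 dual" where
  "dual_eps = Dual 0 1"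

lemma dual_eps_nonzero: "(dual_eps :: 'a::comm_ring_1 dual) \<noteq> 0"
  by (simp add: dual_eps_def zero_dual_def)

lemma dual_eps_square: "(dual_eps :: 'a::comm_ring_1 dual)\<^sup>2 = 0"
  by (simp add: dual_eps_def zero_dual_def times_dual_def power2_eq_square)

lemma Dual_eq: "Dual a b = Dual a 0 + dual_eps * Dual b 0"
  by (simp add: dual_eps_def plus_dual_def times_dual_def)

text \<open>
  The norm of \<open>a + \<epsilon> b\<close> is meant for \<open>a \<noteq> 0\<close>. For \<open>a = 0\<close> the convention \<open>x / 0 = 0\<close> makes it \<open>0\<close>,
  so vectors with \<open>a = 0\<close> are never dual unit vectors.
\<close>

definition dual_norm :: "(real ^ 3) dual \<Rightarrow> real dual" where
  "dual_norm d = Dual (norm (rpart d)) ((rpart d \<bullet> dpart d) / norm (rpart d))"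

definition dual_unit_vector :: "(real ^ 3) dual \<Rightarrow> bool" where
  "dual_unit_vector d \<longleftrightarrow> dual_norm d = 1"

lemma dual_unit_vector_iff:
  "dual_unit_vector d \<longleftrightarrow> norm (rpart d) = 1 \<and> rpart d \<bullet> dpart d = 0"
  by (auto simp: dual_unit_vector_def dual_norm_def one_dual_def)

fun jacobsthal3 :: "nat \<Rightarrow> nat" where
  "jacobsthal3 0 = 0"
| "jacobsthal3 (Suc 0) = 1"
| "jacobsthal3 (Suc (Suc 0)) = 1"
| "jacobsthal3 (Suc (Suc (Suc n))) =
     jacobsthal3 (Suc (Suc n)) + jacobsthal3 (Suc n) + 2 * jacobsthal3 n"

definition jacobsthal3_vec :: "nat \<Rightarrow> real ^ 3" where
  "jacobsthal3_vec n =
     vector [real (jacobsthal3 n), real (jacobsthal3 (n + 1)), real (jacobsthal3 (n + 2))]"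

definition dual_jacobsthal3_vec :: "nat \<Rightarrow> (real ^ 3) dual" where
  "dual_jacobsthal3_vec n = Dual (jacobsthal3_vec n) (jacobsthal3_vec (n + 1))"

definition H :: "int \<Rightarrow> real \<Rightarrow> real \<Rightarrow> real" where
  "H n a b = (if n mod 3 = 0 then a else if n mod 3 = 1 then b else - (a + b))"

definition U :: "int \<Rightarrow> real" where
  "U n = H n 0 1"

end

theory Submission
  imports Defs
begin

text \<open>
  The characteristic polynomial \<open>x\<^sup>3 - x\<^sup>2 - x - 2 = (x - 2) (x\<^sup>2 + x + 1)\<close> of the recurrence has the
  root \<open>2\<close> and the two primitive cube roots of unity. So every solution is a multiple of \<open>2 ^ n\<close> plus
  a sequence of period 3 whose consecutive triples sum to zero, and the latter are exactly the
  sequences \<open>H n a b\<close>. The initial values give the Binet formula \<open>jacobsthal3_binet\<close>. Substituting it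
  into the squared norm of the vector and into its inner product with the next one, each splits into a
  power of \<open>4\<close> (product of geometric parts), a cross term, which is \<open>2 ^ n\<close> times a sequence of
  period 3, and a constant (product of periodic parts):
  \<^item> seven times the squared norm is \<open>3 * 2 ^ (2 * (n + 1)) - 2 ^ (n + 2) * U n + 2\<close>;
  \<^item> seven times the inner product is \<open>3 * 2 ^ (2 * n + 3) - 2 ^ (n + 1) * (U n - U (n + 2)) - 1\<close>.

  A dual vector is a unit vector iff the first quantity is \<open>7\<close> and the second is \<open>0\<close>, and these are
  the two stated equations.
\<close>

text \<open>
  Shifting the index acts linearly on the parameters, so that all the terms below can be expressed
  through \<open>H\<close> at the same index.
\<close>

lemma H_shift: "H (m + 1) a b = H m b (- (a + b))"
proof -
  have "m mod 3 = 0 \<or> m mod 3 = 1 \<or> m mod 3 = 2"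
    by presburger
  moreover have "(m + 1) mod 3 = (m mod 3 + 1) mod 3"
    by presburger
  ultimately show ?thesis
    by (auto simp: H_def)
qed

lemma H_shift2: "H (m + 2) a b = H m (- (a + b)) a"
  using H_shift[of "m + 1" a b] by (simp add: H_shift add.assoc)

lemma H_period: "H (m + 3) a b = H m a b"
  using H_shift[of "m + 2" a b] by (simp add: H_shift2 add.assoc)

text \<open>
  The periodic part starts with \<open>2, -3, 1\<close>, the values that turn \<open>2, 4, 8\<close> into seven times the
  initial values \<open>0, 1, 1\<close>.
\<close>

lemma jacobsthal3_binet: "7 * real (jacobsthal3 n) = 2 ^ (n + 1) - H (int n) 2 (- 3)"
proof (induction n rule: jacobsthal3.induct)
  case (4 n)
  have shifts: "int (Suc n) = int n + 1" "int (Suc (Suc n)) = int n + 2"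
      "int (Suc (Suc (Suc n))) = int n + 3"
    by simp_all
  have "H (int n) 2 (- 3) + H (int n + 1) 2 (- 3) + H (int n + 2) 2 (- 3) = 0"
    unfolding H_shift H_shift2 by (simp add: H_def)
  then show ?case
    using 4 unfolding shifts H_period by simp
qed (simp_all add: H_def)

lemma jacobsthal3_vec_inner:
  "jacobsthal3_vec m \<bullet> jacobsthal3_vec n =
    real (jacobsthal3 m) * real (jacobsthal3 n) +
    real (jacobsthal3 (m + 1)) * real (jacobsthal3 (n + 1)) +
    real (jacobsthal3 (m + 2)) * real (jacobsthal3 (n + 2))"
  by (simp add: jacobsthal3_vec_def inner_vec_def sum_3 vector_3)

text \<open>
  With every entry of two consecutive vectors written in terms of \<open>2 ^ n\<close> and \<open>n mod 3\<close>, the two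
  evaluations below become polynomial identities in \<open>2 ^ n\<close>, one for each residue of \<open>n\<close>.
\<close>

lemma jacobsthal3_window:
  shows "real (jacobsthal3 n) = (2 * 2 ^ n - H (int n) 2 (- 3)) / 7"
    and "real (jacobsthal3 (n + 1)) = (4 * 2 ^ n - H (int n) (- 3) 1) / 7"
    and "real (jacobsthal3 (n + 2)) = (8 * 2 ^ n - H (int n) 1 2) / 7"
    and "real (jacobsthal3 (n + 3)) = (16 * 2 ^ n - H (int n) 2 (- 3)) / 7"
proof -
  have shifts: "int (n + 1) = int n + 1" "int (n + 2) = int n + 2" "int (n + 3) = int n + 3"
    by simp_all
  show "real (jacobsthal3 n) = (2 * 2 ^ n - H (int n) 2 (- 3)) / 7"
    using jacobsthal3_binet[of n] by simp
  show "real (jacobsthal3 (n + 1)) = (4 * 2 ^ n - H (int n) (- 3) 1) / 7"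
    using jacobsthal3_binet[of "n + 1"] unfolding shifts H_shift by simp
  show "real (jacobsthal3 (n + 2)) = (8 * 2 ^ n - H (int n) 1 2) / 7"
    using jacobsthal3_binet[of "n + 2"] unfolding shifts H_shift2 by simp
  show "real (jacobsthal3 (n + 3)) = (16 * 2 ^ n - H (int n) 2 (- 3)) / 7"
    using jacobsthal3_binet[of "n + 3"] unfolding shifts H_period by (simp add: power_add)
qed

text \<open>
  If the periodic parts of the entries are \<open>v\<^sub>0, v\<^sub>1, v\<^sub>2\<close>, a cyclic rearrangement of \<open>2, -3, 1\<close>, then
  \<open>v\<^sub>0\<^sup>2 + v\<^sub>1\<^sup>2 + v\<^sub>2\<^sup>2 = 14\<close> and the cross term contains \<open>v\<^sub>0 + 2 v\<^sub>1 + 4 v\<^sub>2 = 7 U n\<close>.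
\<close>

lemma jacobsthal3_vec_norm_sq:
  "7 * (jacobsthal3_vec n \<bullet> jacobsthal3_vec n) =
    3 * 2 ^ (2 * (n + 1)) - 2 ^ (n + 2) * U (int n) + 2"
proof -
  have "(2::real) ^ (2 * (n + 1)) = 4 * (2 ^ n)\<^sup>2"
    by (simp add: power_mult power2_eq_square flip: power_mult_distrib)
  then show ?thesis
    unfolding jacobsthal3_vec_inner jacobsthal3_window[of n]
    by (simp add: U_def H_def field_simps power2_eq_square)
qed

text \<open>
  With the same notation, the products of the periodic parts contribute
  \<open>v\<^sub>0 v\<^sub>1 + v\<^sub>1 v\<^sub>2 + v\<^sub>2 v\<^sub>0 = ((v\<^sub>0 + v\<^sub>1 + v\<^sub>2)\<^sup>2 - 14) / 2 = -7\<close>.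
\<close>

lemma jacobsthal3_vec_inner_Suc:
  "7 * (jacobsthal3_vec n \<bullet> jacobsthal3_vec (n + 1)) =
    3 * 2 ^ (2 * n + 3) - 2 ^ (n + 1) * (U (int n) - U (int n + 2)) - 1"
proof -
  have "(2::real) ^ (2 * n + 3) = 8 * (2 ^ n)\<^sup>2"
    by (simp add: power_add power_mult power2_eq_square flip: power_mult_distrib)
  moreover have "n + 1 + 1 = n + 2" "n + 1 + 2 = n + 3"
    by simp_all
  ultimately show ?thesis
    unfolding jacobsthal3_vec_inner U_def H_shift2
    by (simp only: jacobsthal3_window[of n]) (simp add: H_def field_simps power2_eq_square)
qed

theorem theorem3p1:
  fixes n :: nat
  shows "dual_unit_vector (dual_jacobsthal3_vec n) \<longleftrightarrow>
    3 * 2 ^ (2 * (n + 1)) - 2 ^ (n + 2) * U (int n) = 5 \<and>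
    3 * 2 ^ (2 * n + 3) - 2 ^ (n + 1) * (U (int n) - U (int n + 2)) = 1"
proof -
  have "dual_unit_vector (dual_jacobsthal3_vec n) \<longleftrightarrow>
      7 * (jacobsthal3_vec n \<bullet> jacobsthal3_vec n) = 7 \<and>
      7 * (jacobsthal3_vec n \<bullet> jacobsthal3_vec (n + 1)) = 0"
    by (simp add: dual_unit_vector_iff dual_jacobsthal3_vec_def norm_eq_1)
  then show ?thesis
    unfolding jacobsthal3_vec_norm_sq jacobsthal3_vec_inner_Suc by linarith
qed

end
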